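(* Let $H$ be an infinite dimensional separable Hilbert space and $I$ a countable index set. Let $w=\{w_j\}_{j\in I}$ be a frame sequence in $H$ with canonical dual $\widetilde w=\{\widetilde w_j\}_{j\in I}$, $f=\{f_i\}_{i\in I}$ a frame for $H$ and $u=\{u_i\}_{i\in I}$ a Parseval frame for $H$ such that $(G(\widetilde w,w)^t-\mathcal I)G(u,f)=\mathbf 0$, i.e. $\sum_{k\in I}\langle\widetilde w_k,w_j\rangle\langle u_k,f_i\rangle=\langle u_j,f_i\rangle$ for all $i,j\in I$. Suppose that the sequence $\{y_i\}_{i\in I}$ given by $y_i:=\sum_{k\in I}\langle u_k,f_i\rangle\widetilde w_k$ is a Parseval frame for $\overline{span}\{w_j\}_{j\in I}$, and that there exists a weak R-dual $\{p_j\}_{j\in I}$ of $f$ with respect to $u$ and a Parseval frame $h=\{h_i\}_{i\in I}$ for $H$ such that $\dim((span\{w_j\})^\perp)\le\dim((span\{p_j\})^\perp)$. Then there exists a coisometry $U:H\to H$ such that $w_j=\sum_{i\in I}\langle f_i,u_j\rangle U(h_i)$ for all $j\in I$. In particular, if the two dimensions are equal, then $w$ is a weak R-dual of $f$ with respect to the Parseval frames $u$ and $U(h)=\{U(h_i)\}_{i\in I}$.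
   Context: Inner products are linear in the first variable. A sequence $\{f_i\}_{i\in I}$ in $H$ is a frame for $H$ if there are $0<A\le B<\infty$ with $A\|x\|^2\le\sum_{i}|\langle x,f_i\rangle|^2\le B\|x\|^2$ for all $x\in H$; it is a Parseval frame if one can take $A=B=1$. A sequence is a frame sequence if it is a frame for its closed linear span. The canonical dual of a frame sequence $w$ is $\widetilde w_j=S_w^{-1}w_j$, where $S_w g=\sum_j\langle g,w_j\rangle w_j$ is the frame operator of $w$ on $\overline{span}\{w_j\}$. A coisometry is a bounded linear operator whose adjoint is an isometry. Dimensions are Hilbert space dimensions (finite or $\infty$; all spaces are separable). For sequences $g,h$ in $H$ indexed by $I$, $G(g,h)$ denotes the matrix $(\langle g_i,h_j\rangle)_{i,j\in I}$, $G(g,h)^t$ its transpose, and $\mathcal I$ the infinite identity matrix. Weak R-dual: let $u,v$ be Parseval frames for $H$ and $f$ a sequence in $H$ such that $\sum_{i\in I}|\langle f_i,u_j\rangle|^2<\infty$ for all $j\in I$ and $(G(v,v)^t-\mathcal I)G(f,u)=\mathbf 0$ (i.e. $\sum_{k}\langle v_k,v_i\rangle\langle f_k,u_j\rangle=\langle f_i,u_j\rangle$ for all $i,j$). Then the sequence $w=\{w_j\}_{j\in I}$ given by $w_j=\sum_{i\in I}\langle f_i,u_j\rangle v_i$ is called the weak R-dual of $f$ with respect to $u$ and $v$. (So "$w$ is a weak R-dual of $f$ with respect to $u$ and $v$" means that all these conditions hold.) *)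

theory Defs
  imports "HOL-Analysis.Analysis" "HOL-Library.Extended_Nat"
begin

text \<open>
  Complex inner product spaces, built on \<^class>\<open>real_inner\<close>, whose inner product is
  required to be the real part of the complex one; norm and topology are therefore the
  usual ones.  The complex inner product is linear in the first variable.
\<close>

class complex_inner = real_inner +
  fixes scaleC :: "complex \<Rightarrow> 'a \<Rightarrow> 'a"  (infixr "*\<^sub>C" 75)
    and cinner :: "'a \<Rightarrow> 'a \<Rightarrow> complex"
  assumes scaleC_add_right: "c *\<^sub>C (x + y) = c *\<^sub>C x + c *\<^sub>C y"
    and scaleC_add_left: "(c + d) *\<^sub>C x = c *\<^sub>C x + d *\<^sub>C x"
    and scaleC_scaleC: "c *\<^sub>C d *\<^sub>C x = (c * d) *\<^sub>C x"
    and scaleR_eq_scaleC: "r *\<^sub>R x = complex_of_real r *\<^sub>C x"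
    and cinner_commute: "cinner x y = cnj (cinner y x)"
    and cinner_add_left: "cinner (x + y) z = cinner x z + cinner y z"
    and cinner_scaleC_left: "cinner (c *\<^sub>C x) y = c * cinner x y"
    and inner_eq_Re_cinner: "inner x y = Re (cinner x y)"

instantiation complex :: complex_inner
begin

definition scaleC_complex :: "complex \<Rightarrow> complex \<Rightarrow> complex"
  where "scaleC_complex c x = c * x"

definition cinner_complex :: "complex \<Rightarrow> complex \<Rightarrow> complex"
  where "cinner_complex x y = x * cnj y"

instance
  by standard
    (simp_all add: scaleC_complex_def cinner_complex_def algebra_simps scaleR_conv_of_real
      inner_complex_def)

end

global_interpretation complex_vector: vector_space "scaleC :: complex \<Rightarrow> 'a \<Rightarrow> 'a::complex_inner"
  defines cspan = "module.span (scaleC :: complex \<Rightarrow> 'a \<Rightarrow> 'a::complex_inner)"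
proof
  fix x :: 'a
  have "1 *\<^sub>C x = complex_of_real 1 *\<^sub>C x"
    by simp
  also have "\<dots> = x"
    by (simp only: scaleR_eq_scaleC[symmetric] scaleR_one)
  finally show "1 *\<^sub>C x = x" .
qed (simp_all only: scaleC_add_right scaleC_add_left scaleC_scaleC)

text \<open>A complex Hilbert space; separability is the class \<^class>\<open>second_countable_topology\<close>.\<close>

class chilbert_space = complex_inner + complete_space


section \<open>Subspaces and Hilbert space dimension\<close>

definition closed_cspan :: "'a::complex_inner set \<Rightarrow> 'a set"
  where "closed_cspan S = closure (cspan S)"

definition cperp :: "'a::complex_inner set \<Rightarrow> 'a set"
  where "cperp S = {x. \<forall>y\<in>S. cinner x y = 0}"

definition is_onb :: "'a::complex_inner set \<Rightarrow> 'a set \<Rightarrow> bool"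
  where "is_onb B M \<longleftrightarrow>
    B \<subseteq> M \<and> (\<forall>x\<in>B. \<forall>y\<in>B. cinner x y = (if x = y then 1 else 0)) \<and> closed_cspan B = M"

text \<open>
  The dimension of a closed subspace \<open>M\<close> is the cardinality of an orthonormal basis of \<open>M\<close>,
  all infinite cardinalities being identified (as is appropriate in separable spaces).
\<close>

definition hilbert_dim :: "'a::complex_inner set \<Rightarrow> enat"
  where "hilbert_dim M =
    (let B = (SOME B. is_onb B M) in if finite B then enat (card B) else \<infinity>)"


section \<open>Coisometries\<close>

definition bounded_clinear :: "('a::complex_inner \<Rightarrow> 'b::complex_inner) \<Rightarrow> bool"
  where "bounded_clinear T \<longleftrightarrow>
    Vector_Spaces.linear scaleC scaleC T \<and> (\<exists>K. \<forall>x. norm (T x) \<le> norm x * K)"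

definition cadjoint :: "('a::complex_inner \<Rightarrow> 'b::complex_inner) \<Rightarrow> 'b \<Rightarrow> 'a"
  where "cadjoint T = (SOME T'. \<forall>x y. cinner (T x) y = cinner x (T' y))"

definition is_isometry :: "('a::complex_inner \<Rightarrow> 'b::complex_inner) \<Rightarrow> bool"
  where "is_isometry T \<longleftrightarrow> bounded_clinear T \<and> (\<forall>x. norm (T x) = norm x)"

definition coisometry :: "('a::chilbert_space \<Rightarrow> 'b::chilbert_space) \<Rightarrow> bool"
  where "coisometry T \<longleftrightarrow> bounded_clinear T \<and> is_isometry (cadjoint T)"


section \<open>Frames\<close>

text \<open>
  Sequences indexed by \<open>I\<close> are functions of which only the values on \<open>I\<close> matter.
  \<open>frame_bounds I f M A B\<close> says that \<open>f\<close> is a sequence in the closed subspace \<open>M\<close> which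
  satisfies the frame inequalities on \<open>M\<close> with bounds \<open>A\<close> and \<open>B\<close>.  Summability is demanded
  separately because a divergent \<open>infsum\<close> is 0.
\<close>

definition frame_bounds :: "'i set \<Rightarrow> ('i \<Rightarrow> 'a::complex_inner) \<Rightarrow> 'a set \<Rightarrow> real \<Rightarrow> real \<Rightarrow> bool"
  where "frame_bounds I f M A B \<longleftrightarrow>
    f ` I \<subseteq> M \<and>
    (\<forall>x\<in>M. (\<lambda>i. (cmod (cinner x (f i)))\<^sup>2) summable_on I \<and>
      A * (norm x)\<^sup>2 \<le> (\<Sum>\<^sub>\<infinity>i\<in>I. (cmod (cinner x (f i)))\<^sup>2) \<and>
      (\<Sum>\<^sub>\<infinity>i\<in>I. (cmod (cinner x (f i)))\<^sup>2) \<le> B * (norm x)\<^sup>2)"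

definition is_frame :: "'i set \<Rightarrow> ('i \<Rightarrow> 'a::complex_inner) \<Rightarrow> 'a set \<Rightarrow> bool"
  where "is_frame I f M \<longleftrightarrow> (\<exists>A B. 0 < A \<and> A \<le> B \<and> frame_bounds I f M A B)"

definition is_parseval_frame :: "'i set \<Rightarrow> ('i \<Rightarrow> 'a::complex_inner) \<Rightarrow> 'a set \<Rightarrow> bool"
  where "is_parseval_frame I f M \<longleftrightarrow> frame_bounds I f M 1 1"

definition is_frame_sequence :: "'i set \<Rightarrow> ('i \<Rightarrow> 'a::complex_inner) \<Rightarrow> bool"
  where "is_frame_sequence I w \<longleftrightarrow> is_frame I w (closed_cspan (w ` I))"

definition frame_op :: "'i set \<Rightarrow> ('i \<Rightarrow> 'a::complex_inner) \<Rightarrow> 'a \<Rightarrow> 'a"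
  where "frame_op I w g = (\<Sum>\<^sub>\<infinity>j\<in>I. cinner g (w j) *\<^sub>C w j)"

text \<open>
  The inverse of the frame operator is taken on the closed span of \<open>w\<close>, on which the frame
  operator of a frame sequence is bijective.
\<close>

definition canonical_dual :: "'i set \<Rightarrow> ('i \<Rightarrow> 'a::complex_inner) \<Rightarrow> 'i \<Rightarrow> 'a"
  where "canonical_dual I w j = inv_into (closed_cspan (w ` I)) (frame_op I w) (w j)"


section \<open>Weak R-duals\<close>

definition is_weak_R_dual ::
  "'i set \<Rightarrow> ('i \<Rightarrow> 'a::complex_inner) \<Rightarrow> ('i \<Rightarrow> 'a) \<Rightarrow> ('i \<Rightarrow> 'a) \<Rightarrow> ('i \<Rightarrow> 'a) \<Rightarrow> bool"
  where "is_weak_R_dual I w f u v \<longleftrightarrow>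
    is_parseval_frame I u UNIV \<and> is_parseval_frame I v UNIV \<and>
    (\<forall>j\<in>I. (\<lambda>i. (cmod (cinner (f i) (u j)))\<^sup>2) summable_on I) \<and>
    (\<forall>i\<in>I. \<forall>j\<in>I.
      ((\<lambda>k. cinner (v k) (v i) * cinner (f k) (u j)) has_sum cinner (f i) (u j)) I) \<and>
    (\<forall>j\<in>I. ((\<lambda>i. cinner (f i) (u j) *\<^sub>C v i) has_sum w j) I)"

end

theory Submission
  imports Defs
begin

text \<open>
  Both biorthogonality conditions say that \<open>\<langle>w\<^sub>j, y\<^sub>i\<rangle> = \<langle>f\<^sub>i, u\<^sub>j\<rangle> = \<langle>p\<^sub>j, h\<^sub>i\<rangle>\<close>, so reconstruction with the
  Parseval frames \<open>y\<close> and \<open>h\<close> shows that \<open>T x = \<Sum>\<^sub>i \<langle>x, y\<^sub>i\<rangle> h\<^sub>i\<close> maps \<open>w\<^sub>j\<close> to \<open>p\<^sub>j\<close> and that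
  its adjoint maps \<open>p\<^sub>j\<close> back to \<open>w\<^sub>j\<close>.  By the assumption on the dimensions, \<open>T\<close> extends from
  the closed span of \<open>w\<close> to an isometry of \<open>H\<close> which maps the orthogonal complement of \<open>w\<close>
  into that of \<open>p\<close>.  The adjoint \<open>U\<close> of this isometry is the coisometry, and applying it to
  \<open>p\<^sub>j = \<Sum>\<^sub>i \<langle>f\<^sub>i, u\<^sub>j\<rangle> h\<^sub>i\<close> gives the expansion of \<open>w\<^sub>j\<close>.
\<close>

section \<open>Complex inner products\<close>

lemma cinner_add_right: "cinner x (y + z) = cinner x y + cinner x (z :: 'a::complex_inner)"
  by (metis cinner_add_left cinner_commute complex_cnj_add)

lemma cinner_scaleC_right: "cinner x (c *\<^sub>C y) = cnj c * cinner x (y :: 'a::complex_inner)"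
  by (metis cinner_commute cinner_scaleC_left complex_cnj_mult)

text \<open>Conjugate symmetry makes the value real, and its real part is the real inner product
  that defines the norm.\<close>

lemma cinner_self: "cinner x x = complex_of_real ((norm (x :: 'a::complex_inner))\<^sup>2)"
proof -
  have "cinner x x = cnj (cinner x x)"
    by (rule cinner_commute)
  then have "Im (cinner x x) = 0"
    by (metis Reals_cnj_iff complex_is_Real_iff)
  then show ?thesis
    by (simp add: complex_eq_iff power2_norm_eq_inner inner_eq_Re_cinner)
qed

lemma norm_scaleC: "norm (c *\<^sub>C x) = cmod c * norm (x :: 'a::complex_inner)"
proof -
  have "cinner (c *\<^sub>C x) (c *\<^sub>C x) = c * cnj c * cinner x x"
    by (simp add: cinner_scaleC_left cinner_scaleC_right)
  then have "complex_of_real ((norm (c *\<^sub>C x))\<^sup>2) = complex_of_real ((cmod c * norm x)\<^sup>2)"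
    by (simp add: cinner_self power_mult_distrib flip: complex_norm_square)
  then show ?thesis
    by (simp only: of_real_eq_iff power2_eq_iff_nonneg norm_ge_zero mult_nonneg_nonneg)
qed

text \<open>Multiplying \<open>x\<close> by a unimodular \<open>c\<close> turns the complex inner
  product into its modulus, so the real Cauchy-Schwarz inequality applies to
  \<open>c *\<^sub>C x\<close>.\<close>

lemma cmod_cinner_le: "cmod (cinner x y) \<le> norm x * norm (y :: 'a::complex_inner)"
proof -
  obtain c where c: "cmod c = 1" "c * cinner x y = cmod (cinner x y)"
  proof (cases "cinner x y = 0")
    case True
    then show ?thesis
      using that[of 1] by simp
  next
    case False
    show ?thesis
    proof (rule that)
      show "cmod (cnj (cinner x y) / cmod (cinner x y)) = 1"
        using False by (simp add: norm_divide)
      show "cnj (cinner x y) / cmod (cinner x y) * cinner x y = cmod (cinner x y)"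
        using False by (simp add: field_simps complex_norm_square[symmetric] power2_eq_square)
    qed
  qed
  have "cmod (cinner x y) = inner (c *\<^sub>C x) y"
    unfolding inner_eq_Re_cinner cinner_scaleC_left c(2) by simp
  also have "\<dots> \<le> norm (c *\<^sub>C x) * norm y"
    by (rule norm_cauchy_schwarz)
  finally show ?thesis
    by (simp add: norm_scaleC c)
qed

global_interpretation cinner: bounded_bilinear "cinner :: 'a::complex_inner \<Rightarrow> 'a \<Rightarrow> complex"
proof
  show "cinner (r *\<^sub>R x) y = r *\<^sub>R cinner x y" for r and x y :: 'a
    by (simp only: scaleR_eq_scaleC[of r x] cinner_scaleC_left scaleR_conv_of_real)
  show "cinner x (r *\<^sub>R y) = r *\<^sub>R cinner x y" for r and x y :: 'a
    by (simp only: scaleR_eq_scaleC[of r y] cinner_scaleC_right scaleR_conv_of_real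
        complex_cnj_complex_of_real)
  show "\<exists>K. \<forall>x y :: 'a. norm (cinner x y) \<le> norm x * norm y * K"
    by (intro exI[of _ 1]) (simp add: cmod_cinner_le)
qed (simp_all add: cinner_add_left cinner_add_right)

declare cinner.zero_left [simp] cinner.zero_right [simp]

global_interpretation scaleC: bounded_bilinear "scaleC :: complex \<Rightarrow> 'a::complex_inner \<Rightarrow> 'a"
proof
  show "(r *\<^sub>R c) *\<^sub>C x = r *\<^sub>R c *\<^sub>C x" for r c and x :: 'a
    by (simp only: scaleR_eq_scaleC[of r "c *\<^sub>C x"] scaleC_scaleC scaleR_conv_of_real)
  show "c *\<^sub>C r *\<^sub>R x = r *\<^sub>R c *\<^sub>C x" for r c and x :: 'a
    by (simp only: scaleR_eq_scaleC[where 'a = 'a] scaleC_scaleC mult.commute)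
  show "\<exists>K. \<forall>c (x :: 'a). norm (c *\<^sub>C x) \<le> norm c * norm x * K"
    by (intro exI[of _ 1]) (simp add: norm_scaleC)
qed (simp_all add: scaleC_add_left scaleC_add_right)

lemma eq_if_cinner_eq:
  fixes x y :: "'a::complex_inner"
  assumes "\<And>z. cinner z x = cinner z y"
  shows "x = y"
proof -
  have "cinner (x - y) (x - y) = 0"
    by (simp add: cinner.diff_right assms)
  then show ?thesis
    by (simp add: cinner_self)
qed

lemma norm_diff_sq:
  "(norm (x - y))\<^sup>2 = (norm x)\<^sup>2 - 2 * Re (cinner x y) + (norm (y :: 'a::complex_inner))\<^sup>2"
  unfolding inner_eq_Re_cinner[symmetric] power2_norm_eq_inner
  by (simp add: inner_diff_left inner_diff_right inner_commute[of y x])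

section \<open>Closed subspaces\<close>

lemma subset_closed_cspan: "S \<subseteq> closed_cspan S"
  unfolding closed_cspan_def using closure_subset complex_vector.span_superset by blast

lemma closed_closed_cspan [simp]: "closed (closed_cspan S)"
  by (simp add: closed_cspan_def)

lemma subspace_closed_cspan [simp]: "complex_vector.subspace (closed_cspan S)"
proof (rule complex_vector.subspaceI)
  show "0 \<in> closed_cspan S"
    unfolding closed_cspan_def using closure_subset complex_vector.span_zero by blast
next
  fix x y
  assume "x \<in> closed_cspan S" "y \<in> closed_cspan S"
  then obtain a b where "\<And>n. a n \<in> cspan S" "a \<longlonglongrightarrow> x" "\<And>n. b n \<in> cspan S" "b \<longlonglongrightarrow> y"
    unfolding closed_cspan_def closure_sequential by blast
  then show "x + y \<in> closed_cspan S"
    unfolding closed_cspan_def closure_sequential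
    by (intro exI[of _ "\<lambda>n. a n + b n"]) (auto intro: complex_vector.span_add tendsto_add)
next
  fix c x
  assume "x \<in> closed_cspan S"
  then obtain a where "\<And>n. a n \<in> cspan S" "a \<longlonglongrightarrow> x"
    unfolding closed_cspan_def closure_sequential by blast
  then show "c *\<^sub>C x \<in> closed_cspan S"
    unfolding closed_cspan_def closure_sequential
    by (intro exI[of _ "\<lambda>n. c *\<^sub>C a n"])
      (auto intro: complex_vector.span_scale scaleC.tendsto[OF tendsto_const])
qed

lemma closed_cspan_minimal:
  assumes "S \<subseteq> M" "complex_vector.subspace M" "closed M"
  shows "closed_cspan S \<subseteq> M"
  unfolding closed_cspan_def
  by (simp add: assms closure_minimal complex_vector.span_minimal)

lemma has_sum_in_closed_subspace:
  fixes M :: "'a::complex_inner set"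
  assumes "(g has_sum s) I" "complex_vector.subspace M" "closed M" "\<And>i. i \<in> I \<Longrightarrow> g i \<in> M"
  shows "s \<in> M"
proof (rule Lim_in_closed_set[OF \<open>closed M\<close>])
  show "(sum g \<longlongrightarrow> s) (finite_subsets_at_top I)"
    using assms(1) by (simp add: has_sum_def)
  show "\<forall>\<^sub>F F in finite_subsets_at_top I. sum g F \<in> M"
    using assms by (intro eventually_finite_subsets_at_top_weakI complex_vector.subspace_sum) auto
qed simp

lemma subspace_cperp [simp]: "complex_vector.subspace (cperp S)"
  by (rule complex_vector.subspaceI) (auto simp: cperp_def cinner_add_left cinner_scaleC_left)

lemma closed_cperp [simp]: "closed (cperp S)"
proof -
  have "cperp S = (\<Inter>y\<in>S. (\<lambda>x. cinner x y) -` {0})"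
    by (auto simp: cperp_def)
  moreover have "closed ((\<lambda>x. cinner x y) -` {0})" for y :: 'a
    by (intro closed_vimage) (auto intro!: cinner.continuous_on continuous_intros)
  ultimately show ?thesis
    by auto
qed

lemma cinner_cperp_closed_cspan:
  assumes "x \<in> cperp (cspan S)" "y \<in> closed_cspan S"
  shows "cinner x y = 0" "cinner y x = 0"
proof -
  have "closed_cspan S \<subseteq> (\<lambda>y. cinner x y) -` {0}"
    unfolding closed_cspan_def
  proof (rule closure_minimal)
    show "cspan S \<subseteq> (\<lambda>y. cinner x y) -` {0}"
      using assms(1) by (auto simp: cperp_def)
    show "closed ((\<lambda>y. cinner x y) -` {0})"
      by (intro closed_vimage) (auto intro!: cinner.continuous_on continuous_intros)
  qed
  then show "cinner x y = 0"
    using assms(2) by auto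
  then show "cinner y x = 0"
    by (metis cinner_commute complex_cnj_zero)
qed

lemma cperp_cspanI:
  assumes "\<And>y. y \<in> S \<Longrightarrow> cinner x y = 0"
  shows "x \<in> cperp (cspan S)"
proof -
  have "complex_vector.subspace {y. cinner x y = 0}"
    by (rule complex_vector.subspaceI) (auto simp: cinner_add_right cinner_scaleC_right)
  then have "cspan S \<subseteq> {y. cinner x y = 0}"
    using assms by (intro complex_vector.span_minimal) auto
  then show ?thesis
    by (auto simp: cperp_def)
qed

section \<open>Bessel sequences and mixed frame operators\<close>

text \<open>The Bessel condition in synthesis form. Finite sums raise no question of convergence,
  and a bound of this kind transfers easily along an operator that is bounded below, as for the
  canonical dual. The usual form, a bound on the coefficients, is derived below.\<close>

definition bessel :: "'i set \<Rightarrow> ('i \<Rightarrow> 'a::complex_inner) \<Rightarrow> real \<Rightarrow> bool"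
  where "bessel I g K \<longleftrightarrow> 0 \<le> K \<and>
    (\<forall>F c. finite F \<longrightarrow> F \<subseteq> I \<longrightarrow>
      (norm (\<Sum>i\<in>F. c i *\<^sub>C g i))\<^sup>2 \<le> K * (\<Sum>i\<in>F. (cmod (c i))\<^sup>2))"

lemma besselD:
  assumes "bessel I g K" "finite F" "F \<subseteq> I"
  shows "(norm (\<Sum>i\<in>F. c i *\<^sub>C g i))\<^sup>2 \<le> K * (\<Sum>i\<in>F. (cmod (c i))\<^sup>2)"
  using assms unfolding bessel_def by blast

text \<open>
  For a finite sum \<open>x = \<Sum> c\<^sub>i f\<^sub>i\<close> the expansion of \<open>\<langle>x, x\<rangle>\<close> is estimated by the Cauchy-Schwarz
  inequality and the upper frame bound at \<open>x\<close>.
\<close>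

lemma bessel_if_frame_bounds:
  assumes fb: "frame_bounds I f M A B" and M: "complex_vector.subspace M" and "0 \<le> B"
  shows "bessel I f B"
  unfolding bessel_def
proof (intro conjI allI impI)
  show "0 \<le> B" by fact
  fix F c
  assume F: "finite F" "F \<subseteq> I"
  define x where "x = (\<Sum>i\<in>F. c i *\<^sub>C f i)"
  have "x \<in> M"
    unfolding x_def using fb F
    by (intro complex_vector.subspace_sum[OF M] complex_vector.subspace_scale[OF M])
      (auto simp: frame_bounds_def)
  define s where "s = (\<Sum>i\<in>F. (cmod (cinner x (f i)))\<^sup>2)"
  have "s \<le> (\<Sum>\<^sub>\<infinity>i\<in>I. (cmod (cinner x (f i)))\<^sup>2)"
    unfolding s_def using fb F \<open>x \<in> M\<close> by (intro finite_sum_le_infsum) (auto simp: frame_bounds_def)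
  then have s: "s \<le> B * (norm x)\<^sup>2"
    using fb \<open>x \<in> M\<close> unfolding frame_bounds_def by fastforce
  define t where "t = (\<Sum>i\<in>F. (cmod (c i))\<^sup>2)"
  have "complex_of_real ((norm x)\<^sup>2) = (\<Sum>i\<in>F. cnj (c i) * cinner x (f i))"
    unfolding cinner_self[symmetric]
    by (subst (2) x_def) (simp add: cinner.sum_right cinner_scaleC_right)
  then have "(norm x)\<^sup>2 = cmod (\<Sum>i\<in>F. cnj (c i) * cinner x (f i))"
    by (metis abs_power2 norm_of_real real_norm_def)
  also have "\<dots> \<le> (\<Sum>i\<in>F. cmod (c i) * cmod (cinner x (f i)))"
    by (rule sum_norm_le) (simp add: norm_mult)
  finally have "((norm x)\<^sup>2)\<^sup>2 \<le> (\<Sum>i\<in>F. cmod (c i) * cmod (cinner x (f i)))\<^sup>2"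
    by (intro power_mono) auto
  also have "\<dots> \<le> t * s"
    unfolding s_def t_def by (rule Cauchy_Schwarz_ineq_sum)
  also have "\<dots> \<le> t * (B * (norm x)\<^sup>2)"
    using s by (intro mult_left_mono) (auto simp: t_def intro: sum_nonneg)
  finally have *: "(norm x)\<^sup>2 * (norm x)\<^sup>2 \<le> (B * t) * (norm x)\<^sup>2"
    by (simp add: power2_eq_square mult_ac)
  have "(norm x)\<^sup>2 \<le> B * t"
  proof (cases "x = 0")
    case True
    then show ?thesis
      using \<open>0 \<le> B\<close> by (simp add: t_def sum_nonneg)
  next
    case False
    then show ?thesis
      using mult_right_le_imp_le[OF *] by simp
  qed
  then show "(norm (\<Sum>i\<in>F. c i *\<^sub>C f i))\<^sup>2 \<le> B * (\<Sum>i\<in>F. (cmod (c i))\<^sup>2)"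
    by (simp add: x_def t_def)
qed

lemma bessel_if_parseval:
  assumes "is_parseval_frame I f M" "complex_vector.subspace M"
  shows "bessel I f 1"
  using bessel_if_frame_bounds[of I f M 1 1] assms by (simp add: is_parseval_frame_def)

text \<open>Pythagoras: in the double sum for the squared norm only the diagonal survives.\<close>

lemma bessel_if_orthonormal:
  assumes "\<And>i j. i \<in> I \<Longrightarrow> j \<in> I \<Longrightarrow> cinner (e i) (e j) = (if i = j then 1 else 0)"
  shows "bessel I e 1"
  unfolding bessel_def
proof (intro conjI allI impI)
  fix F c
  assume F: "finite F" "F \<subseteq> I"
  have "complex_of_real ((norm (\<Sum>i\<in>F. c i *\<^sub>C e i))\<^sup>2)
      = (\<Sum>i\<in>F. \<Sum>j\<in>F. c i * (cnj (c j) * cinner (e i) (e j)))"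
    unfolding cinner_self[symmetric]
    by (simp only: cinner.sum_left)
      (simp add: cinner.sum_right cinner_scaleC_left cinner_scaleC_right sum_distrib_left
        mult.left_commute)
  also have "\<dots> = (\<Sum>i\<in>F. \<Sum>j\<in>F. if i = j then c i * cnj (c j) else 0)"
    using F by (intro sum.cong refl) (auto simp: assms subset_eq)
  also have "\<dots> = (\<Sum>i\<in>F. c i * cnj (c i))"
    using F by (simp add: sum.delta)
  also have "\<dots> = complex_of_real (\<Sum>i\<in>F. (cmod (c i))\<^sup>2)"
    by (simp add: complex_norm_square del: of_real_power)
  finally show "(norm (\<Sum>i\<in>F. c i *\<^sub>C e i))\<^sup>2 \<le> 1 * (\<Sum>i\<in>F. (cmod (c i))\<^sup>2)"
    by (simp only: of_real_eq_iff mult_1 order_refl)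
qed simp

text \<open>Duality between synthesis and analysis: the coefficient sum \<open>t\<close> equals
  \<langle>x, z\<rangle> for the vector \<open>z\<close> synthesized from the coefficients
  themselves, whose squared norm is at most \<open>K * t\<close>. Cauchy-Schwarz then leaves one
  factor \<open>t\<close> to cancel.\<close>

lemma bessel_finite_coeffs_le:
  assumes g: "bessel I g K" and F: "finite F" "F \<subseteq> I"
  shows "(\<Sum>i\<in>F. (cmod (cinner x (g i)))\<^sup>2) \<le> K * (norm x)\<^sup>2"
proof -
  define t where "t = (\<Sum>i\<in>F. (cmod (cinner x (g i)))\<^sup>2)"
  define z where "z = (\<Sum>i\<in>F. cinner x (g i) *\<^sub>C g i)"
  have "0 \<le> t"
    by (simp add: t_def sum_nonneg)
  have "complex_of_real t = cinner x z"
    by (simp add: z_def t_def cinner.sum_right cinner_scaleC_right complex_norm_square mult.commute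
        del: of_real_power)
  then have "t = cmod (cinner x z)"
    using \<open>0 \<le> t\<close> by (metis abs_of_nonneg norm_of_real)
  also have "\<dots> \<le> norm x * norm z"
    by (rule cmod_cinner_le)
  finally have "t\<^sup>2 \<le> (norm x)\<^sup>2 * (norm z)\<^sup>2"
    using \<open>0 \<le> t\<close> by (metis power_mono power_mult_distrib)
  also have "\<dots> \<le> (norm x)\<^sup>2 * (K * t)"
    unfolding z_def t_def by (intro mult_left_mono besselD[OF g F]) simp
  finally have *: "t * t \<le> (K * (norm x)\<^sup>2) * t"
    by (simp add: power2_eq_square mult_ac)
  show ?thesis
  proof (cases "t = 0")
    case True
    then show ?thesis
      using g by (simp add: bessel_def flip: t_def)
  next
    case False
    then show ?thesis
      using mult_right_le_imp_le[OF *] \<open>0 \<le> t\<close> by (simp flip: t_def)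
  qed
qed

lemma bessel_coeffs_summable:
  assumes "bessel I g K"
  shows "(\<lambda>i. (cmod (cinner x (g i)))\<^sup>2) summable_on I"
  using bessel_finite_coeffs_le[OF assms]
  by (intro nonneg_bdd_above_summable_on) (auto intro!: bdd_aboveI)

lemma bessel_coeffs_le:
  assumes "bessel I g K"
  shows "(\<Sum>\<^sub>\<infinity>i\<in>I. (cmod (cinner x (g i)))\<^sup>2) \<le> K * (norm x)\<^sup>2"
  by (rule has_sum_le_finite_sums[OF has_sum_infsum[OF bessel_coeffs_summable[OF assms]]])
    (rule bessel_finite_coeffs_le[OF assms])

text \<open>Cauchy criterion for the net of finite partial sums: outside a large finite set the sums
  of \<open>d\<close> are small, hence so are those of \<open>g\<close>. No sign is assumed for
  \<open>d\<close> or \<open>C\<close>, hence the absolute values.\<close>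

lemma summable_on_if_sums_dominated:
  fixes g :: "'i \<Rightarrow> 'a::{real_normed_vector, complete_space}"
  assumes d: "d summable_on I"
    and le: "\<And>F. finite F \<Longrightarrow> F \<subseteq> I \<Longrightarrow> (norm (sum g F))\<^sup>2 \<le> C * sum d F"
  shows "g summable_on I"
proof -
  have *: "norm (sum g F) < e"
    if F: "finite F" "F \<subseteq> I" "\<bar>sum d F\<bar> < e\<^sup>2 / (\<bar>C\<bar> + 1)" and "0 < e" for F e
  proof -
    have "(norm (sum g F))\<^sup>2 \<le> C * sum d F"
      using le F by blast
    also have "\<dots> \<le> \<bar>C\<bar> * \<bar>sum d F\<bar>"
      by (metis abs_ge_self abs_mult)
    also have "\<dots> \<le> \<bar>sum d F\<bar> * (\<bar>C\<bar> + 1)"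
      by (simp add: algebra_simps)
    also have "\<dots> < e\<^sup>2"
      using F(3) by (subst (asm) pos_less_divide_eq) auto
    finally show ?thesis
      using \<open>0 < e\<close> by (intro power_less_imp_less_base[of _ 2 e]) auto
  qed
  obtain L where L: "(sum d \<longlongrightarrow> L) (finite_subsets_at_top I)"
    using d by (auto simp: summable_on_def has_sum_def)
  have "cauchy_filter (filtermap (sum g) (finite_subsets_at_top I))"
    unfolding cauchy_filter_metric_filtermap
  proof (intro allI impI)
    fix e :: real
    assume "0 < e"
    \<comment> \<open>This bound on a tail sum of \<open>d\<close> forces the tail of
      \<open>g\<close> below \<open>e / 2\<close>; two comparisons with \<open>F0\<close> then give
      \<open>e\<close>. The summand 1 keeps the denominator positive.\<close>
    define r where "r = (e / 2)\<^sup>2 / (\<bar>C\<bar> + 1)"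
    have "0 < r"
      using \<open>0 < e\<close> by (simp add: r_def add_nonneg_pos)
    then have "\<forall>\<^sub>F F in finite_subsets_at_top I. dist (sum d F) L < r / 2"
      using tendstoD[OF L, of "r / 2"] by simp
    then obtain F0 where "finite F0 \<and> F0 \<subseteq> I \<and>
        (\<forall>F. finite F \<and> F0 \<subseteq> F \<and> F \<subseteq> I \<longrightarrow> dist (sum d F) L < r / 2)"
      unfolding eventually_finite_subsets_at_top ..
    then have F0: "finite F0" "F0 \<subseteq> I"
      "\<And>F. finite F \<Longrightarrow> F0 \<subseteq> F \<Longrightarrow> F \<subseteq> I \<Longrightarrow> dist (sum d F) L < r / 2"
      by simp_all
    have close: "dist (sum g F) (sum g F0) < e / 2" if F: "finite F" "F0 \<subseteq> F" "F \<subseteq> I" for F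
    proof -
      have "\<bar>sum d (F - F0)\<bar> = dist (sum d F) (sum d F0)"
        using F by (simp add: dist_real_def sum_diff)
      also have "\<dots> < r"
        using dist_triangle_half_l[OF F0(3)[OF F] F0(3)[OF F0(1) order_refl F0(2)]] .
      finally have "norm (sum g (F - F0)) < e / 2"
        using F \<open>0 < e\<close> by (intro *) (auto simp: r_def)
      then show ?thesis
        using F by (simp add: dist_norm sum_diff)
    qed
    show "\<exists>P. eventually P (finite_subsets_at_top I) \<and>
        (\<forall>x y. P x \<and> P y \<longrightarrow> dist (sum g x) (sum g y) < e)"
    proof (intro exI conjI allI impI)
      show "\<forall>\<^sub>F F in finite_subsets_at_top I. finite F \<and> F0 \<subseteq> F \<and> F \<subseteq> I"
        unfolding eventually_finite_subsets_at_top using F0 by blast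
      fix F G
      assume "(finite F \<and> F0 \<subseteq> F \<and> F \<subseteq> I) \<and> finite G \<and> F0 \<subseteq> G \<and> G \<subseteq> I"
      then show "dist (sum g F) (sum g G) < e"
        using dist_triangle_half_l[OF close close] by blast
    qed
  qed
  \<comment> \<open>Completeness enters as convergence of proper Cauchy filters.\<close>
  then obtain s where "filtermap (sum g) (finite_subsets_at_top I) \<le> nhds s"
    using complete_UNIV[where 'a = 'a, unfolded complete_uniform, rule_format,
        of "filtermap (sum g) (finite_subsets_at_top I)"]
    by (auto simp: filtermap_bot_iff)
  then have "(sum g \<longlongrightarrow> s) (finite_subsets_at_top I)"
    by (simp add: filterlim_def)
  then show ?thesis
    using summable_on_def has_sum_def by blast
qed

lemma bessel_summable:
  fixes g :: "'i \<Rightarrow> 'a::chilbert_space"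
  assumes "bessel I g K" "(\<lambda>i. (cmod (c i))\<^sup>2) summable_on I"
  shows "(\<lambda>i. c i *\<^sub>C g i) summable_on I"
  using assms(2) besselD[OF assms(1)] by (rule summable_on_if_sums_dominated)

lemma bessel_norm_le:
  assumes g: "bessel I g K" and s: "((\<lambda>i. c i *\<^sub>C g i) has_sum s) I"
    and c: "((\<lambda>i. (cmod (c i))\<^sup>2) has_sum t) I"
  shows "(norm s)\<^sup>2 \<le> K * t"
proof (rule tendsto_le)
  show "((\<lambda>F. (norm (\<Sum>i\<in>F. c i *\<^sub>C g i))\<^sup>2) \<longlongrightarrow> (norm s)\<^sup>2) (finite_subsets_at_top I)"
    using s unfolding has_sum_def by (intro tendsto_intros)
  show "((\<lambda>F. K * (\<Sum>i\<in>F. (cmod (c i))\<^sup>2)) \<longlongrightarrow> K * t) (finite_subsets_at_top I)"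
    using c unfolding has_sum_def by (intro tendsto_intros)
  show "\<forall>\<^sub>F F in finite_subsets_at_top I.
      (norm (\<Sum>i\<in>F. c i *\<^sub>C g i))\<^sup>2 \<le> K * (\<Sum>i\<in>F. (cmod (c i))\<^sup>2)"
    using besselD[OF g] by (intro eventually_finite_subsets_at_top_weakI)
qed simp

text \<open>Analysis with \<open>a\<close> followed by synthesis with \<open>b\<close>. It covers
  frame operators (\<open>a = b\<close>), the transfer from one frame to another, and, over an
  orthonormal index set, projections and the linear extension of a map of basis vectors.\<close>

definition mixed_op :: "'i set \<Rightarrow> ('i \<Rightarrow> 'a::complex_inner) \<Rightarrow> ('i \<Rightarrow> 'a) \<Rightarrow> 'a \<Rightarrow> 'a"
  where "mixed_op I a b x = (\<Sum>\<^sub>\<infinity>i\<in>I. cinner x (a i) *\<^sub>C b i)"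

lemma mixed_op_has_sum:
  fixes a b :: "'i \<Rightarrow> 'a::chilbert_space"
  assumes "bessel I a K" "bessel I b L"
  shows "((\<lambda>i. cinner x (a i) *\<^sub>C b i) has_sum mixed_op I a b x) I"
  unfolding mixed_op_def
  by (intro has_sum_infsum bessel_summable[OF assms(2)] bessel_coeffs_summable[OF assms(1)])

lemma has_sum_scaleC:
  fixes g :: "'i \<Rightarrow> 'a::complex_inner"
  assumes "(g has_sum s) I"
  shows "((\<lambda>i. c *\<^sub>C g i) has_sum c *\<^sub>C s) I"
  by (rule has_sum_bounded_linear[OF scaleC.bounded_linear_right assms])

lemma has_sum_cinner_left:
  fixes g :: "'i \<Rightarrow> 'a::complex_inner"
  assumes "(g has_sum s) I"
  shows "((\<lambda>i. cinner (g i) z) has_sum cinner s z) I"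
  by (rule has_sum_bounded_linear[OF cinner.bounded_linear_left assms])

lemma has_sum_cinner_right:
  fixes g :: "'i \<Rightarrow> 'a::complex_inner"
  assumes "(g has_sum s) I"
  shows "((\<lambda>i. cinner z (g i)) has_sum cinner z s) I"
  by (rule has_sum_bounded_linear[OF cinner.bounded_linear_right assms])

lemma bounded_clinear_mixed_op:
  fixes a b :: "'i \<Rightarrow> 'a::chilbert_space"
  assumes a: "bessel I a K" and b: "bessel I b L"
  shows "bounded_clinear (mixed_op I a b)"
  unfolding bounded_clinear_def
proof
  note hs = mixed_op_has_sum[OF a b]
  show "Vector_Spaces.linear scaleC scaleC (mixed_op I a b)"
  proof
    fix x y
    have "((\<lambda>i. cinner (x + y) (a i) *\<^sub>C b i) has_sum mixed_op I a b x + mixed_op I a b y) I"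
      using has_sum_add[OF hs[of x] hs[of y]] by (simp add: cinner_add_left scaleC_add_left)
    then show "mixed_op I a b (x + y) = mixed_op I a b x + mixed_op I a b y"
      by (rule has_sum_unique[OF hs])
  next
    fix c x
    have "((\<lambda>i. cinner (c *\<^sub>C x) (a i) *\<^sub>C b i) has_sum c *\<^sub>C mixed_op I a b x) I"
      using has_sum_scaleC[OF hs[of x], of c] by (simp add: cinner_scaleC_left scaleC_scaleC)
    then show "mixed_op I a b (c *\<^sub>C x) = c *\<^sub>C mixed_op I a b x"
      by (rule has_sum_unique[OF hs])
  qed
  have KL: "0 \<le> K" "0 \<le> L"
    using a b by (auto simp: bessel_def)
  have "norm (mixed_op I a b x) \<le> norm x * sqrt (L * K)" for x
  proof -
    have "(norm (mixed_op I a b x))\<^sup>2 \<le> L * (\<Sum>\<^sub>\<infinity>i\<in>I. (cmod (cinner x (a i)))\<^sup>2)"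
      by (rule bessel_norm_le[OF b hs has_sum_infsum[OF bessel_coeffs_summable[OF a]]])
    also have "\<dots> \<le> L * (K * (norm x)\<^sup>2)"
      using bessel_coeffs_le[OF a] KL by (intro mult_left_mono) auto
    also have "\<dots> = (norm x * sqrt (L * K))\<^sup>2"
      unfolding power_mult_distrib real_sqrt_pow2[OF mult_nonneg_nonneg[OF KL(2,1)]]
      by (simp only: mult_ac)
    finally show ?thesis
      by (rule power2_le_imp_le) (simp add: KL)
  qed
  then show "\<exists>K. \<forall>x. norm (mixed_op I a b x) \<le> norm x * K"
    by blast
qed

text \<open>Taking the adjoint exchanges analysis and synthesis: both inner products expand into the
  same series.\<close>

lemma mixed_op_adjoint:
  fixes a b :: "'i \<Rightarrow> 'a::chilbert_space"
  assumes a: "bessel I a K" and b: "bessel I b L"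
  shows "cinner (mixed_op I a b x) z = cinner x (mixed_op I b a z)"
proof -
  have "((\<lambda>i. cinner x (a i) * cinner (b i) z) has_sum cinner (mixed_op I a b x) z) I"
    using has_sum_cinner_left[OF mixed_op_has_sum[OF a b, of x], of z]
    by (simp add: cinner_scaleC_left)
  moreover have "((\<lambda>i. cinner x (a i) * cinner (b i) z) has_sum cinner x (mixed_op I b a z)) I"
    using has_sum_cinner_right[OF mixed_op_has_sum[OF b a, of z], of x]
    unfolding cinner_scaleC_right cinner_commute[of _ z, symmetric] by (simp only: mult.commute)
  ultimately show ?thesis
    by (rule has_sum_unique)
qed

section \<open>Frame operators\<close>

lemma mixed_op_in_closed_subspace:
  fixes a b :: "'i \<Rightarrow> 'a::chilbert_space"
  assumes "bessel I a K" "bessel I b L" "complex_vector.subspace M" "closed M" "b ` I \<subseteq> M"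
  shows "mixed_op I a b x \<in> M"
  by (rule has_sum_in_closed_subspace[OF mixed_op_has_sum[OF assms(1,2)] assms(3,4)])
    (use assms(3,5) in \<open>auto intro: complex_vector.subspace_scale\<close>)

lemma frame_op_eq_mixed_op: "frame_op I f = mixed_op I f f"
  by (simp add: fun_eq_iff frame_op_def mixed_op_def)

text \<open>The quadratic form of the frame operator is the sum in the frame inequalities, which
  thereby become operator inequalities.\<close>

lemma frame_op_coeffs:
  fixes f :: "'i \<Rightarrow> 'a::chilbert_space"
  assumes f: "bessel I f K"
  shows "((\<lambda>i. (cmod (cinner x (f i)))\<^sup>2) has_sum Re (cinner x (frame_op I f x))) I"
proof -
  have "((\<lambda>i. cinner x (cinner x (f i) *\<^sub>C f i)) has_sum cinner x (frame_op I f x)) I"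
    unfolding frame_op_eq_mixed_op by (rule has_sum_cinner_right[OF mixed_op_has_sum[OF f f]])
  moreover have "cinner x (cinner x (f i) *\<^sub>C f i) = complex_of_real ((cmod (cinner x (f i)))\<^sup>2)" for i
    by (simp add: cinner_scaleC_right complex_norm_square mult.commute del: of_real_power)
  ultimately show ?thesis
    using has_sum_Re by fastforce
qed

text \<open>The first bound is the lower frame inequality; the second is the Bessel bound for the
  vector synthesized from the coefficients of \<open>x\<close>.\<close>

lemma frame_op_bounds:
  fixes f :: "'i \<Rightarrow> 'a::chilbert_space"
  assumes fb: "frame_bounds I f M A B" and M: "complex_vector.subspace M" and "0 \<le> B" "x \<in> M"
  shows "A * (norm x)\<^sup>2 \<le> Re (cinner x (frame_op I f x))"
    and "(norm (frame_op I f x))\<^sup>2 \<le> B * Re (cinner x (frame_op I f x))"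
proof -
  have f: "bessel I f B"
    using fb M \<open>0 \<le> B\<close> by (rule bessel_if_frame_bounds)
  have "(\<Sum>\<^sub>\<infinity>i\<in>I. (cmod (cinner x (f i)))\<^sup>2) = Re (cinner x (frame_op I f x))"
    by (rule infsumI[OF frame_op_coeffs[OF f]])
  then show "A * (norm x)\<^sup>2 \<le> Re (cinner x (frame_op I f x))"
    using fb \<open>x \<in> M\<close> unfolding frame_bounds_def by metis
  show "(norm (frame_op I f x))\<^sup>2 \<le> B * Re (cinner x (frame_op I f x))"
    unfolding frame_op_eq_mixed_op
    by (rule bessel_norm_le[OF f mixed_op_has_sum[OF f f]])
      (rule frame_op_coeffs[OF f, unfolded frame_op_eq_mixed_op])
qed

text \<open>For A = B = 1 both \<parallel>x\<parallel>^2 and \<parallel>Sx\<parallel>^2 are at most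
  Re \<langle>x, Sx\<rangle>, so expanding \<parallel>x - Sx\<parallel>^2 leaves something
  nonpositive.\<close>

lemma parseval_reconstruction:
  fixes y :: "'i \<Rightarrow> 'a::chilbert_space"
  assumes y: "is_parseval_frame I y M" and M: "complex_vector.subspace M" and x: "x \<in> M"
  shows "mixed_op I y y x = x"
proof -
  have "(norm (x - frame_op I y x))\<^sup>2 \<le> 0"
    unfolding norm_diff_sq
    using frame_op_bounds[OF y[unfolded is_parseval_frame_def] M _ x] by simp
  then show ?thesis
    by (simp add: frame_op_eq_mixed_op)
qed

section \<open>Bounded complex-linear operators\<close>

lemma bounded_clinear_bounded_linear:
  assumes "bounded_clinear T"
  shows "bounded_linear T"
proof -
  interpret T: Vector_Spaces.linear scaleC scaleC T
    using assms by (simp add: bounded_clinear_def)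
  show ?thesis
  proof
    show "\<exists>K. \<forall>x. norm (T x) \<le> norm x * K"
      using assms by (simp add: bounded_clinear_def)
  qed (simp_all add: T.add T.scale scaleR_eq_scaleC)
qed

lemma bounded_clinear_scaleC: "bounded_clinear T \<Longrightarrow> T (c *\<^sub>C x) = c *\<^sub>C T x"
  unfolding bounded_clinear_def Vector_Spaces.linear_def module_hom_def module_hom_axioms_def by blast

lemma bounded_clinearI:
  assumes "bounded_linear T" "\<And>c x. T (c *\<^sub>C x) = c *\<^sub>C T x"
  shows "bounded_clinear T"
proof -
  interpret bounded_linear T by fact
  have "Vector_Spaces.linear scaleC scaleC T"
    by standard (simp_all add: add assms(2))
  then show ?thesis
    using bounded by (simp add: bounded_clinear_def)
qed

text \<open>Lets an identity such as \<open>U (T x) = x\<close> spread from generators to their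
  closed span.\<close>

lemma fixed_points_closed_subspace:
  assumes "bounded_clinear T"
  shows "complex_vector.subspace {x. T x = x}" "closed {x. T x = x}"
proof -
  interpret bounded_linear T
    using assms by (rule bounded_clinear_bounded_linear)
  show "complex_vector.subspace {x. T x = x}"
    by (rule complex_vector.subspaceI) (auto simp: add zero bounded_clinear_scaleC[OF assms])
  show "closed {x. T x = x}"
    by (intro closed_Collect_eq linear_continuous_on continuous_on_id bounded_linear_axioms)
qed

section \<open>Inverting the frame operator; the canonical dual\<close>

lemma frame_op_norm_ge:
  fixes f :: "'i \<Rightarrow> 'a::chilbert_space"
  assumes "frame_bounds I f M A B" "complex_vector.subspace M" "0 \<le> B" "x \<in> M"
  shows "A * norm x \<le> norm (frame_op I f x)"
proof (cases "x = 0")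
  case False
  have "A * (norm x)\<^sup>2 \<le> Re (cinner x (frame_op I f x))"
    using assms by (rule frame_op_bounds)
  also have "\<dots> \<le> norm x * norm (frame_op I f x)"
    using norm_cauchy_schwarz[of x "frame_op I f x"] by (simp add: inner_eq_Re_cinner)
  finally show ?thesis
    using False by (simp add: power2_eq_square)
qed simp

text \<open>
  The solution is the fixed point of \<open>x \<mapsto> x - (S x - v) / B\<close>, a contraction because
  \<open>\<parallel>d - S d / B\<parallel>\<^sup>2 = \<parallel>d\<parallel>\<^sup>2 - 2 \<langle>d, S d\<rangle> / B + \<parallel>S d\<parallel>\<^sup>2 / B\<^sup>2 \<le> \<parallel>d\<parallel>\<^sup>2 - \<langle>d, S d\<rangle> / B\<close>.
\<close>

lemma frame_op_surj:
  fixes f :: "'i \<Rightarrow> 'a::chilbert_space"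
  assumes fb: "frame_bounds I f M A B" and AB: "0 < A" "A \<le> B"
    and M: "complex_vector.subspace M" "closed M" and v: "v \<in> M"
  shows "\<exists>x\<in>M. frame_op I f x = v"
proof -
  let ?S = "frame_op I f"
  have f: "bessel I f B"
    using bessel_if_frame_bounds[OF fb M(1)] AB by simp
  interpret S: bounded_linear ?S
    unfolding frame_op_eq_mixed_op
    by (intro bounded_clinear_bounded_linear bounded_clinear_mixed_op[OF f f])
  have SM: "?S x \<in> M" for x
    unfolding frame_op_eq_mixed_op
    using fb by (intro mixed_op_in_closed_subspace[OF f f M]) (auto simp: frame_bounds_def)
  \<comment> \<open>The contraction constant; the root appears because the estimate is for squared
    norms, and \<open>A \<le> B\<close> makes it real.\<close>
  define c where "c = sqrt (1 - A / B)"
  have c: "0 \<le> c" "c < 1" "c\<^sup>2 = 1 - A / B"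
    using AB by (auto simp: c_def)
  define F where "F x = x - (1 / B) *\<^sub>R (?S x - v)" for x
  have "\<exists>!x\<in>M. F x = x"
  proof (rule Banach_fix)
    show "complete M"
      using \<open>closed M\<close> by (simp add: complete_eq_closed)
    show "M \<noteq> {}"
      using v by blast
    show "0 \<le> c" "c < 1"
      by fact+
    show "F ` M \<subseteq> M"
      by (auto simp: F_def scaleR_eq_scaleC
          intro!: complex_vector.subspace_diff[OF M(1)] complex_vector.subspace_scale[OF M(1)] SM v)
  next
    fix x y
    assume "x \<in> M" "y \<in> M"
    define d where "d = x - y"
    define r where "r = Re (cinner d (?S d))"
    have "d \<in> M"
      unfolding d_def by (intro complex_vector.subspace_diff M) fact+
    have r: "A * (norm d)\<^sup>2 \<le> r" "(norm (?S d))\<^sup>2 \<le> B * r"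
      using frame_op_bounds[OF fb M(1) _ \<open>d \<in> M\<close>] AB by (auto simp: r_def)
    have "F x - F y = d - (1 / B) *\<^sub>R ?S d"
      by (simp add: F_def d_def S.diff algebra_simps)
    then have "(norm (F x - F y))\<^sup>2 = (norm d)\<^sup>2 - 2 * (r / B) + (norm (?S d))\<^sup>2 / B\<^sup>2"
      using AB
      by (simp add: norm_diff_sq r_def cinner.scaleR_right power_mult_distrib power_divide)
    also have "\<dots> \<le> (norm d)\<^sup>2 - 2 * (r / B) + (B * r) / B\<^sup>2"
      using r by (intro add_left_mono divide_right_mono) auto
    also have "\<dots> = (norm d)\<^sup>2 - r / B"
      using AB by (simp add: power2_eq_square)
    also have "\<dots> \<le> (norm d)\<^sup>2 - A * (norm d)\<^sup>2 / B"
      using r AB by (intro diff_left_mono divide_right_mono) auto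
    also have "\<dots> = (c * norm d)\<^sup>2"
      by (simp add: power_mult_distrib c algebra_simps)
    finally have "norm (F x - F y) \<le> c * norm d"
      by (rule power2_le_imp_le) (simp add: c)
    then show "dist (F x) (F y) \<le> c * dist x y"
      by (simp add: dist_norm d_def)
  qed
  then obtain x where x: "x \<in> M" "F x = x"
    by blast
  have "(1 / B) *\<^sub>R (?S x - v) = x - F x"
    by (simp only: F_def diff_diff_eq2 add_diff_cancel_left')
  also have "\<dots> = 0"
    by (simp only: x(2) diff_self)
  finally have "?S x = v"
    using AB by simp
  then show ?thesis
    using x(1) by blast
qed

text \<open>The frame operator sends a combination of dual vectors to the same combination of the
  \<open>w i\<close>. It is bounded below by \<open>A\<close> on the closed span and
  \<open>w\<close> has Bessel bound \<open>B\<close>, which gives \<open>B / A\<^sup>2\<close> for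
  the dual.\<close>

lemma canonical_dual_bessel:
  fixes w :: "'i \<Rightarrow> 'a::chilbert_space"
  assumes "is_frame_sequence I w"
  obtains K where "bessel I (canonical_dual I w) K"
proof -
  let ?W = "closed_cspan (w ` I)" and ?d = "canonical_dual I w"
  obtain A B where AB: "0 < A" "A \<le> B" and fb: "frame_bounds I w ?W A B"
    using assms by (auto simp: is_frame_sequence_def is_frame_def)
  have w: "bessel I w B"
    using bessel_if_frame_bounds[OF fb] AB by simp
  have d: "?d j \<in> ?W" "frame_op I w (?d j) = w j" if "j \<in> I" for j
  proof -
    have "w j \<in> ?W"
      using that by (intro subsetD[OF subset_closed_cspan] imageI)
    then obtain x where "x \<in> ?W" "frame_op I w x = w j"
      using frame_op_surj[OF fb AB subspace_closed_cspan closed_closed_cspan, of "w j"] by auto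
    \<comment> \<open>\<open>inv_into\<close> is a genuine preimage only on the image, so
      surjectivity has to come first.\<close>
    then have "w j \<in> frame_op I w ` ?W"
      by (metis imageI)
    then show "?d j \<in> ?W" "frame_op I w (?d j) = w j"
      unfolding canonical_dual_def by (rule inv_into_into, rule f_inv_into_f)
  qed
  have lin: "bounded_clinear (frame_op I w)"
    unfolding frame_op_eq_mixed_op by (rule bounded_clinear_mixed_op[OF w w])
  interpret S: bounded_linear "frame_op I w"
    by (rule bounded_clinear_bounded_linear[OF lin])
  have "bessel I ?d (B / A\<^sup>2)"
    unfolding bessel_def
  proof (intro conjI allI impI)
    show "0 \<le> B / A\<^sup>2"
      using AB by simp
    fix F c
    assume F: "finite F" "F \<subseteq> I"
    define x where "x = (\<Sum>i\<in>F. c i *\<^sub>C ?d i)"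
    have "x \<in> ?W"
      unfolding x_def using F d
      by (intro complex_vector.subspace_sum complex_vector.subspace_scale) auto
    have Sx: "frame_op I w x = (\<Sum>i\<in>F. c i *\<^sub>C w i)"
      unfolding x_def S.sum using F d
      by (intro sum.cong refl) (auto simp: bounded_clinear_scaleC[OF lin])
    have "(A * norm x)\<^sup>2 \<le> (norm (frame_op I w x))\<^sup>2"
      using frame_op_norm_ge[OF fb _ _ \<open>x \<in> ?W\<close>] AB by (intro power_mono) auto
    also have "\<dots> \<le> B * (\<Sum>i\<in>F. (cmod (c i))\<^sup>2)"
      unfolding Sx by (rule besselD[OF w F])
    finally show "(norm (\<Sum>i\<in>F. c i *\<^sub>C ?d i))\<^sup>2 \<le> B / A\<^sup>2 * (\<Sum>i\<in>F. (cmod (c i))\<^sup>2)"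
      using AB by (simp add: x_def power_mult_distrib field_simps)
  qed
  then show thesis
    by (rule that)
qed

section \<open>Orthonormal bases\<close>

definition orthonormal :: "'a::complex_inner set \<Rightarrow> bool"
  where "orthonormal B \<longleftrightarrow> (\<forall>x\<in>B. \<forall>y\<in>B. cinner x y = (if x = y then 1 else 0))"

lemma bessel_orthonormal: "orthonormal B \<Longrightarrow> bessel B (\<lambda>b. b) 1"
  by (rule bessel_if_orthonormal) (auto simp: orthonormal_def)

lemma orthonormal_expansion:
  fixes B :: "'a::chilbert_space set"
  assumes B: "orthonormal B" and b: "b \<in> B" and e: "bessel B e K"
  shows "mixed_op B (\<lambda>b. b) e b = e b"
proof -
  have "((\<lambda>b'. cinner b b' *\<^sub>C e b') has_sum e b) B"
  proof (rule has_sum_finite_neutralI[of "{b}"])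
    fix b'
    assume "b' \<in> B - {b}"
    then show "cinner b b' *\<^sub>C e b' = 0"
      using B b by (auto simp: orthonormal_def scaleC.zero_left)
  qed (use B b in \<open>auto simp: orthonormal_def complex_vector.scale_one\<close>)
  then show ?thesis
    unfolding mixed_op_def by (rule infsumI)
qed

text \<open>Zorn's lemma gives a maximal orthonormal subset of \<open>M\<close>. A vector of
  \<open>M\<close> outside its closed span would have a nonzero residual after projection, and
  normalizing that residual would enlarge the set.\<close>

lemma ex_onb:
  fixes M :: "'a::chilbert_space set"
  assumes M: "complex_vector.subspace M" "closed M"
  shows "\<exists>B. is_onb B M"
proof -
  let ?A = "{B. B \<subseteq> M \<and> orthonormal B}"
  have "\<exists>B\<in>?A. \<forall>X\<in>?A. B \<subseteq> X \<longrightarrow> X = B"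
  proof (rule subset_Zorn')
    fix C
    assume C: "subset.chain ?A C"
    have "orthonormal (\<Union>C)"
      unfolding orthonormal_def
    proof (intro ballI)
      fix x y
      assume "x \<in> \<Union>C" "y \<in> \<Union>C"
      then obtain X Y where XY: "x \<in> X" "X \<in> C" "y \<in> Y" "Y \<in> C"
        by blast
      then have "X \<subseteq> Y \<or> Y \<subseteq> X"
        using C by (auto simp: subset_chain_def)
      then obtain Z where "Z \<in> C" "x \<in> Z" "y \<in> Z"
        using XY by blast
      then show "cinner x y = (if x = y then 1 else 0)"
        using C unfolding subset_chain_def orthonormal_def by blast
    qed
    then show "\<Union>C \<in> ?A"
      using C by (auto simp: subset_chain_def)
  qed
  then obtain B where B: "B \<subseteq> M" "orthonormal B"
    and max: "\<And>X. X \<subseteq> M \<Longrightarrow> orthonormal X \<Longrightarrow> B \<subseteq> X \<Longrightarrow> X = B"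
    by auto
  have "closed_cspan B \<subseteq> M"
    by (rule closed_cspan_minimal[OF B(1) M])
  moreover have "x \<in> closed_cspan B" if x: "x \<in> M" for x
  proof (rule ccontr)
    assume notin: "x \<notin> closed_cspan B"
    note bB = bessel_orthonormal[OF B(2)]
    let ?P = "mixed_op B (\<lambda>b. b) (\<lambda>b. b)"
    have P: "?P x \<in> closed_cspan B"
      by (rule mixed_op_in_closed_subspace[OF bB bB]) (auto intro: subsetD[OF subset_closed_cspan])
    define z where "z = x - ?P x"
    have "z \<noteq> 0"
      using notin P by (auto simp: z_def)
    have "z \<in> M"
      unfolding z_def using P \<open>closed_cspan B \<subseteq> M\<close> x by (intro complex_vector.subspace_diff M(1)) auto
    have orth: "cinner z b = 0" "cinner b z = 0" if "b \<in> B" for b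
    proof -
      have "cinner (?P x) b = cinner x b"
        using mixed_op_adjoint[OF bB bB] orthonormal_expansion[OF B(2) that bB] by simp
      then show "cinner z b = 0"
        by (simp add: z_def cinner.diff_left)
      then show "cinner b z = 0"
        by (metis cinner_commute complex_cnj_zero)
    qed
    define e where "e = complex_of_real (1 / norm z) *\<^sub>C z"
    have ee: "cinner e e = 1"
      using \<open>z \<noteq> 0\<close> by (simp add: e_def cinner_self norm_scaleC norm_divide)
    have eb: "cinner e b = 0" "cinner b e = 0" if "b \<in> B" for b
      using orth[OF that] by (simp_all add: e_def cinner_scaleC_left cinner_scaleC_right)
    have "e \<notin> B"
      using ee eb by (metis zero_neq_one)
    moreover have "orthonormal (insert e B)"
      using B(2) ee eb \<open>e \<notin> B\<close> by (auto simp: orthonormal_def)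
    moreover have "insert e B \<subseteq> M"
      using B(1) \<open>z \<in> M\<close> by (auto simp: e_def intro: complex_vector.subspace_scale M)
    ultimately show False
      using max by blast
  qed
  ultimately show ?thesis
    using B unfolding is_onb_def orthonormal_def by blast
qed

text \<open>Distinct orthonormal vectors have distance sqrt 2, so balls of radius 1/2 around them
  are disjoint open sets, of which a second countable space has only countably many.\<close>

lemma countable_orthonormal:
  fixes B :: "'a::{chilbert_space, second_countable_topology} set"
  assumes "orthonormal B"
  shows "countable B"
proof -
  have far: "1 < dist x y" if "x \<in> B" "y \<in> B" "x \<noteq> y" for x y
  proof -
    have "(norm x)\<^sup>2 = 1" "(norm y)\<^sup>2 = 1"
      using assms that cinner_self[of x] cinner_self[of y]
      by (auto simp: orthonormal_def simp del: of_real_power)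
    then have "(dist x y)\<^sup>2 = 2"
      using assms that by (simp add: dist_norm norm_diff_sq orthonormal_def)
    then show ?thesis
      using power_less_imp_less_base[of 1 2 "dist x y"] by simp
  qed
  let ?b = "\<lambda>x. ball x (1 / 2)"
  have disj: "disjnt (?b x) (?b y)" if "x \<in> B" "y \<in> B" "x \<noteq> y" for x y
    using far[OF that] dist_triangle_half_l[of x _ 1 y]
    unfolding disjnt_iff by (metis dist_commute mem_ball not_less_iff_gr_or_eq)
  have "inj_on ?b B"
  proof (rule inj_onI, rule ccontr)
    fix x y
    assume "x \<in> B" "y \<in> B" "?b x = ?b y" "x \<noteq> y"
    then show False
      using disj[of x y] by (simp add: disjnt_def)
  qed
  moreover have "countable (?b ` B)"
  proof (rule countable_disjoint_open_subsets)
    show "pairwise disjnt (?b ` B)"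
      using disj by (auto simp: pairwise_def)
  qed auto
  ultimately show ?thesis
    by (simp add: countable_image_inj_eq)
qed

text \<open>Turns the comparison of dimensions into a map of bases. As all infinite cardinalities
  are identified, an infinite \<open>C\<close> is handled through the countability of
  \<open>B\<close>.\<close>

lemma hilbert_dim_le_imp_inj:
  fixes M N :: "'a::{chilbert_space, second_countable_topology} set"
  assumes M: "complex_vector.subspace M" "closed M" and N: "complex_vector.subspace N" "closed N"
    and le: "hilbert_dim M \<le> hilbert_dim N"
  obtains B C \<phi> where "is_onb B M" "is_onb C N" "inj_on \<phi> B" "\<phi> ` B \<subseteq> C"
proof -
  \<comment> \<open>These are exactly the bases chosen inside \<open>hilbert_dim\<close>, so
    independence of the cardinality from the basis is not at issue.\<close>
  define B where "B = (SOME B. is_onb B M)"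
  define C where "C = (SOME C. is_onb C N)"
  have B: "is_onb B M" and C: "is_onb C N"
    unfolding B_def C_def using ex_onb[OF M] ex_onb[OF N] by (auto intro: someI_ex)
  have dim: "(if finite B then enat (card B) else \<infinity>) \<le> (if finite C then enat (card C) else \<infinity>)"
    using le by (simp only: hilbert_dim_def Let_def B_def C_def)
  have "countable B"
    using B by (intro countable_orthonormal) (simp add: is_onb_def orthonormal_def)
  have "\<exists>\<phi>. inj_on \<phi> B \<and> \<phi> ` B \<subseteq> C"
  proof (cases "finite C")
    case True
    then have "finite B" "card B \<le> card C"
      using dim by (auto split: if_splits)
    then show ?thesis
      using card_le_inj[OF _ True] by blast
  next
    case False
    then obtain g :: "nat \<Rightarrow> 'a" where "inj g" "range g \<subseteq> C"
      using infinite_countable_subset by blast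
    then show ?thesis
      using \<open>countable B\<close>
      by (intro exI[of _ "g \<circ> to_nat_on B"]) (auto intro!: comp_inj_on inj_on_to_nat_on intro: inj_on_subset)
  qed
  then show thesis
    using that B C by blast
qed

section \<open>Weak R-duals\<close>

lemma norm_eq_if_adjoint_left_inverse:
  assumes "\<And>x z. cinner (T x) z = cinner x (U z)" "\<And>x. U (T x) = x"
  shows "norm (T x) = norm x"
proof -
  have "complex_of_real ((norm (T x))\<^sup>2) = complex_of_real ((norm x)\<^sup>2)"
    by (simp only: cinner_self[symmetric] assms)
  then show ?thesis
    by (simp only: of_real_eq_iff power2_eq_iff_nonneg norm_ge_zero)
qed

text \<open>Since \<open>cadjoint\<close> is a choice, it must be identified with \<open>T\<close>
  through uniqueness of adjoints; that \<open>T\<close> is isometric follows from its left inverse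
  being its adjoint.\<close>

lemma coisometryI:
  assumes U: "bounded_clinear U" and T: "bounded_clinear T"
    and adj: "\<And>x z. cinner (T x) z = cinner x (U z)" and UT: "\<And>x. U (T x) = x"
  shows "coisometry U"
proof -
  have adj': "cinner (U x) y = cinner x (T y)" for x y
    by (metis adj cinner_commute)
  have "cadjoint U = T"
    unfolding cadjoint_def
  proof (rule some_equality)
    show "\<forall>x y. cinner (U x) y = cinner x (T y)"
      by (simp add: adj')
    fix T'
    assume "\<forall>x y. cinner (U x) y = cinner x (T' y)"
    then have "cinner z (T' y) = cinner z (T y)" for y z
      by (metis adj')
    then have "T' y = T y" for y
      by (rule eq_if_cinner_eq)
    then show "T' = T"
      by (rule ext)
  qed
  moreover have "norm (T x) = norm x" for x
    using adj UT by (rule norm_eq_if_adjoint_left_inverse)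
  ultimately show ?thesis
    using U T by (simp add: coisometry_def is_isometry_def)
qed

lemma bounded_clinear_add:
  assumes "bounded_clinear S" "bounded_clinear T"
  shows "bounded_clinear (\<lambda>x. S x + T x)"
  by (rule bounded_clinearI[OF bounded_linear_add])
    (simp_all add: assms bounded_clinear_bounded_linear bounded_clinear_scaleC scaleC_add_right)

lemma bounded_clinear_compose:
  assumes "bounded_clinear S" "bounded_clinear T"
  shows "bounded_clinear (\<lambda>x. S (T x))"
  by (rule bounded_clinearI[OF bounded_linear_compose[of S T]])
    (simp_all add: assms bounded_clinear_bounded_linear bounded_clinear_scaleC)

text \<open>
  \<open>T\<close> synthesizes with \<open>h\<close> the coefficients with respect to \<open>y\<close>, and embeds the orthogonal
  complement of \<open>w\<close> into that of \<open>p\<close> by means of orthonormal bases; \<open>U\<close> is its adjoint.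
\<close>

lemma ex_coisometry_section:
  fixes w p y h :: "'i \<Rightarrow> 'a::{chilbert_space, second_countable_topology}"
  assumes y: "is_parseval_frame I y (closed_cspan (w ` I))"
    and h: "is_parseval_frame I h UNIV"
    and coeffs: "\<And>i j. i \<in> I \<Longrightarrow> j \<in> I \<Longrightarrow> cinner (w j) (y i) = cinner (p j) (h i)"
    and dim: "hilbert_dim (cperp (cspan (w ` I))) \<le> hilbert_dim (cperp (cspan (p ` I)))"
  obtains U T where "bounded_clinear U" "bounded_clinear T"
    "\<And>x z. cinner (T x) z = cinner x (U z)" "\<And>x. U (T x) = x"
    "\<And>j. j \<in> I \<Longrightarrow> T (w j) = p j"
proof -
  let ?W = "closed_cspan (w ` I)" and ?W' = "cperp (cspan (w ` I))" and ?P' = "cperp (cspan (p ` I))"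
  obtain B C \<phi> where B: "is_onb B ?W'" and C: "is_onb C ?P'" and \<phi>: "inj_on \<phi> B" "\<phi> ` B \<subseteq> C"
    using hilbert_dim_le_imp_inj[OF subspace_cperp closed_cperp subspace_cperp closed_cperp dim]
    by blast
  have yb: "bessel I y 1"
    using y by (rule bessel_if_parseval) simp
  have hb: "bessel I h 1"
    using h by (rule bessel_if_parseval) simp
  have oB: "orthonormal B"
    using B by (simp add: is_onb_def orthonormal_def)
  have bB: "bessel B (\<lambda>b. b) 1"
    using oB by (rule bessel_orthonormal)
  \<comment> \<open>Injectivity of \<open>\<phi>\<close> keeps distinct basis vectors
    orthogonal.\<close>
  have b\<phi>: "bessel B \<phi> 1"
  proof (rule bessel_if_orthonormal)
    fix b c
    assume "b \<in> B" "c \<in> B"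
    then show "cinner (\<phi> b) (\<phi> c) = (if b = c then 1 else 0)"
      using C \<phi> unfolding is_onb_def by (metis image_subset_iff inj_onD)
  qed
  have w: "w j \<in> ?W" if "j \<in> I" for j
    using that by (intro subsetD[OF subset_closed_cspan] imageI)
  have yW: "y ` I \<subseteq> ?W"
    using y by (simp add: is_parseval_frame_def frame_bounds_def)
  have wB: "cinner (w j) b = 0" if "j \<in> I" "b \<in> B" for j b
    using B that w by (intro cinner_cperp_closed_cspan(2)) (auto simp: is_onb_def)
  have yB: "cinner b (y i) = 0" if "i \<in> I" "b \<in> B" for i b
    using B that yW by (intro cinner_cperp_closed_cspan(1)) (auto simp: is_onb_def)
  have p\<phi>: "cinner (\<phi> b) (p j) = 0" "cinner (p j) (\<phi> b) = 0" if "j \<in> I" "b \<in> B" for j b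
  proof -
    have "\<phi> b \<in> ?P'"
      using C \<phi> that by (auto simp: is_onb_def)
    moreover have "p j \<in> closed_cspan (p ` I)"
      using that by (intro subsetD[OF subset_closed_cspan] imageI)
    ultimately show "cinner (\<phi> b) (p j) = 0" "cinner (p j) (\<phi> b) = 0"
      by (rule cinner_cperp_closed_cspan)+
  qed
  \<comment> \<open>\<open>T1\<close> acts on the closed span of \<open>w\<close> and
    \<open>T2\<close> on its complement; each vanishes on the part that belongs to the other.
    \<open>U1\<close> and \<open>U2\<close> are their adjoints.\<close>
  define T1 where "T1 = mixed_op I y h"
  define T2 where "T2 = mixed_op B (\<lambda>b. b) \<phi>"
  define U1 where "U1 = mixed_op I h y"
  define U2 where "U2 = mixed_op B \<phi> (\<lambda>b. b)"
  define T where "T x = T1 x + T2 x" for x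
  define U where "U z = U1 z + U2 z" for z
  have T: "bounded_clinear T" and U: "bounded_clinear U"
    unfolding T_def U_def T1_def T2_def U1_def U2_def
    by (intro bounded_clinear_add bounded_clinear_mixed_op[OF yb hb] bounded_clinear_mixed_op[OF hb yb]
        bounded_clinear_mixed_op[OF bB b\<phi>] bounded_clinear_mixed_op[OF b\<phi> bB])+
  have adj1: "cinner (T1 x) z = cinner x (U1 z)" for x z
    unfolding T1_def U1_def by (rule mixed_op_adjoint[OF yb hb])
  have adj: "cinner (T x) z = cinner x (U z)" for x z
    using adj1 mixed_op_adjoint[OF bB b\<phi>]
    by (simp add: T_def U_def T2_def U2_def cinner_add_left cinner_add_right)
  have T1w: "T1 (w j) = p j" if "j \<in> I" for j
  proof -
    \<comment> \<open>Equal coefficients turn the sum for \<open>w j\<close> into the Parseval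
      expansion of \<open>p j\<close>; the computation of \<open>U1 (p j)\<close> is the mirror
      image.\<close>
    have "T1 (w j) = mixed_op I h h (p j)"
      unfolding T1_def mixed_op_def using that coeffs by (intro infsum_cong) auto
    then show ?thesis
      using parseval_reconstruction[OF h] by simp
  qed
  have Tw: "T (w j) = p j" if "j \<in> I" for j
  proof -
    have "T2 (w j) = 0"
      unfolding T2_def mixed_op_def using wB that by (intro infsum_0) (simp add: scaleC.zero_left)
    then show ?thesis
      using T1w[OF that] by (simp add: T_def)
  qed
  have Up: "U (p j) = w j" if "j \<in> I" for j
  proof -
    have "U1 (p j) = mixed_op I y y (w j)"
      unfolding U1_def mixed_op_def using that coeffs by (intro infsum_cong) auto
    also have "\<dots> = w j"
      by (rule parseval_reconstruction[OF y subspace_closed_cspan w[OF that]])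
    moreover have "U2 (p j) = 0"
      unfolding U2_def mixed_op_def using p\<phi> that by (intro infsum_0) (simp add: scaleC.zero_left)
    ultimately show ?thesis
      by (simp add: U_def)
  qed
  have Tb: "T b = \<phi> b" if "b \<in> B" for b
  proof -
    have "T1 b = 0"
      unfolding T1_def mixed_op_def using yB that by (intro infsum_0) (simp add: scaleC.zero_left)
    then show ?thesis
      using orthonormal_expansion[OF oB that b\<phi>] by (simp add: T_def T2_def)
  qed
  have U\<phi>: "U (\<phi> b) = b" if "b \<in> B" for b
  proof -
    have "U2 (\<phi> b) = mixed_op B (\<lambda>b. b) (\<lambda>b. b) b"
      unfolding U2_def mixed_op_def
    proof (rule infsum_cong)
      fix c
      assume "c \<in> B"
      then have "cinner (\<phi> b) (\<phi> c) = cinner b c"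
        using that B C \<phi> unfolding is_onb_def by (metis image_subset_iff inj_onD)
      then show "cinner (\<phi> b) (\<phi> c) *\<^sub>C c = cinner b c *\<^sub>C c"
        by simp
    qed
    also have "\<dots> = b"
      by (rule orthonormal_expansion[OF oB that bB])
    finally have U2: "U2 (\<phi> b) = b" .
    \<comment> \<open>\<open>U1 (\<phi> b)\<close> vanishes because it lies in the closed span of
      \<open>w\<close> and is also orthogonal to it: \<langle>w_j, U1 (\<phi> b)\<rangle> =
      \<langle>T1 w_j, \<phi> b\<rangle> = \<langle>p_j, \<phi> b\<rangle> = 0.\<close>
    have "U1 (\<phi> b) \<in> ?W"
      unfolding U1_def using yW by (intro mixed_op_in_closed_subspace[OF hb yb]) auto
    moreover have "U1 (\<phi> b) \<in> ?W'"
    proof (rule cperp_cspanI)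
      fix v
      assume "v \<in> w ` I"
      then obtain j where j: "j \<in> I" "v = w j"
        by blast
      have "cinner v (U1 (\<phi> b)) = 0"
        using p\<phi>(2)[OF j(1) that] by (simp add: j adj1[symmetric] T1w)
      then show "cinner (U1 (\<phi> b)) v = 0"
        by (metis cinner_commute complex_cnj_zero)
    qed
    ultimately have "cinner (U1 (\<phi> b)) (U1 (\<phi> b)) = 0"
      by (intro cinner_cperp_closed_cspan(1))
    then have "U1 (\<phi> b) = 0"
      by (simp add: cinner_self)
    then show ?thesis
      using U2 by (simp add: U_def)
  qed
  have fix_subspace: "complex_vector.subspace {x. U (T x) = x}" "closed {x. U (T x) = x}"
    by (rule fixed_points_closed_subspace[OF bounded_clinear_compose[OF U T]])+
  have fix_W: "?W \<subseteq> {x. U (T x) = x}"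
    by (rule closed_cspan_minimal[OF _ fix_subspace]) (auto simp: Tw Up)
  have "closed_cspan B \<subseteq> {x. U (T x) = x}"
    by (rule closed_cspan_minimal[OF _ fix_subspace]) (auto simp: Tb U\<phi>)
  then have fix_W': "?W' \<subseteq> {x. U (T x) = x}"
    using B by (simp add: is_onb_def)
  have "U (T x) = x" for x
  proof -
    \<comment> \<open>The frame operator of \<open>y\<close> is self-adjoint and fixes the closed
      span of \<open>w\<close>, so it is the orthogonal projection and splits \<open>x\<close> into
      two vectors fixed by \<open>U\<close> after \<open>T\<close>.\<close>
    let ?Q = "mixed_op I y y"
    have Q: "?Q x \<in> ?W"
      using yW by (intro mixed_op_in_closed_subspace[OF yb yb]) auto
    have "x - ?Q x \<in> ?W'"
    proof (rule cperp_cspanI)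
      fix v
      assume "v \<in> w ` I"
      then have "?Q v = v"
        using w by (intro parseval_reconstruction[OF y]) auto
      then show "cinner (x - ?Q x) v = 0"
        by (simp add: cinner.diff_left mixed_op_adjoint[OF yb yb])
    qed
    then have "(x - ?Q x) + ?Q x \<in> {x. U (T x) = x}"
      using Q fix_W fix_W' by (intro complex_vector.subspace_add[OF fix_subspace(1)]) auto
    then show ?thesis
      by simp
  qed
  then show thesis
    using that U T adj Tw by blast
qed

theorem theorem2p13:
  fixes I :: "'i set"
    and w f u p h :: "'i \<Rightarrow> 'a::{chilbert_space, second_countable_topology}"
  assumes "hilbert_dim (UNIV :: 'a set) = \<infinity>"
    and "countable I"
    and "is_frame_sequence I w"
    and "is_frame I f UNIV"
    and "is_parseval_frame I u UNIV"
    and "\<forall>i\<in>I. \<forall>j\<in>I.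
      ((\<lambda>k. cinner (canonical_dual I w k) (w j) * cinner (u k) (f i)) has_sum cinner (u j) (f i)) I"
    and "is_parseval_frame I (\<lambda>i. \<Sum>\<^sub>\<infinity>k\<in>I. cinner (u k) (f i) *\<^sub>C canonical_dual I w k)
      (closed_cspan (w ` I))"
    and "is_parseval_frame I h UNIV"
    and "is_weak_R_dual I p f u h"
    and "hilbert_dim (cperp (cspan (w ` I))) \<le> hilbert_dim (cperp (cspan (p ` I)))"
  shows "\<exists>U :: 'a \<Rightarrow> 'a. coisometry U \<and>
    (\<forall>j\<in>I. ((\<lambda>i. cinner (f i) (u j) *\<^sub>C U (h i)) has_sum w j) I) \<and>
    (hilbert_dim (cperp (cspan (w ` I))) = hilbert_dim (cperp (cspan (p ` I))) \<longrightarrow>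
      is_parseval_frame I (\<lambda>i. U (h i)) UNIV \<and> is_weak_R_dual I w f u (\<lambda>i. U (h i)))"
proof -
  let ?d = "canonical_dual I w" and ?W = "closed_cspan (w ` I)"
  define y where "y i = (\<Sum>\<^sub>\<infinity>k\<in>I. cinner (u k) (f i) *\<^sub>C ?d k)" for i
  have y: "is_parseval_frame I y ?W"
    using assms(7) by (simp add: y_def[abs_def])
  have bu: "bessel I u 1"
    using assms(5) by (rule bessel_if_parseval) simp
  obtain K where bd: "bessel I ?d K"
    using canonical_dual_bessel[OF assms(3)] .
  have wy: "cinner (w j) (y i) = cinner (f i) (u j)" if "i \<in> I" "j \<in> I" for i j
  proof -
    \<comment> \<open>An \<open>infsum\<close> that diverges would be 0. The Bessel bounds of
      \<open>u\<close> and of the dual make \<open>y i\<close> a true sum, so inner products may be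
      taken termwise.\<close>
    have "(\<lambda>k. (cmod (cinner (u k) (f i)))\<^sup>2) summable_on I"
      using bessel_coeffs_summable[OF bu, of "f i"]
      by (simp add: cinner_commute[of "f i"])
    then have yi: "((\<lambda>k. cinner (u k) (f i) *\<^sub>C ?d k) has_sum y i) I"
      unfolding y_def by (intro has_sum_infsum bessel_summable[OF bd])
    have "((\<lambda>k. cinner (?d k) (w j) * cinner (u k) (f i)) has_sum cinner (y i) (w j)) I"
      using has_sum_cinner_left[OF yi, of "w j"] by (simp add: cinner_scaleC_left mult.commute)
    moreover have "((\<lambda>k. cinner (?d k) (w j) * cinner (u k) (f i)) has_sum cinner (u j) (f i)) I"
      using assms(6) that by blast
    ultimately have "cinner (y i) (w j) = cinner (u j) (f i)"
      by (rule has_sum_unique)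
    then show ?thesis
      by (metis cinner_commute)
  qed
  have p: "((\<lambda>i. cinner (f i) (u j) *\<^sub>C h i) has_sum p j) I" if "j \<in> I" for j
    using assms(9) that by (simp add: is_weak_R_dual_def)
  have ph: "cinner (p j) (h i) = cinner (f i) (u j)" if "i \<in> I" "j \<in> I" for i j
  proof -
    have "((\<lambda>k. cinner (h k) (h i) * cinner (f k) (u j)) has_sum cinner (p j) (h i)) I"
      using has_sum_cinner_left[OF p[OF that(2)], of "h i"]
      by (simp add: cinner_scaleC_left mult.commute)
    moreover have "((\<lambda>k. cinner (h k) (h i) * cinner (f k) (u j)) has_sum cinner (f i) (u j)) I"
      using assms(9) that by (simp add: is_weak_R_dual_def)
    ultimately show ?thesis
      by (rule has_sum_unique)
  qed
  obtain U T where U: "bounded_clinear U" and T: "bounded_clinear T"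
    and adj: "\<And>x z. cinner (T x) z = cinner x (U z)" and UT: "\<And>x. U (T x) = x"
    and Tw: "\<And>j. j \<in> I \<Longrightarrow> T (w j) = p j"
  proof (rule ex_coisometry_section[OF y assms(8) _ assms(10)])
    show "cinner (w j) (y i) = cinner (p j) (h i)" if "i \<in> I" "j \<in> I" for i j
      by (simp only: wy[OF that] ph[OF that])
  qed blast
  have coisometry: "coisometry U"
    using U T adj UT by (rule coisometryI)
  have norm_T: "norm (T x) = norm x" for x
    using adj UT by (rule norm_eq_if_adjoint_left_inverse)
  have w: "((\<lambda>i. cinner (f i) (u j) *\<^sub>C U (h i)) has_sum w j) I" if "j \<in> I" for j
    \<comment> \<open>\<open>U\<close> is applied termwise to the expansion of \<open>p j\<close>,
      where U p_j = U (T w_j) = w_j.\<close>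
    using has_sum_bounded_linear[OF bounded_clinear_bounded_linear[OF U] p[OF that]]
    by (simp add: bounded_clinear_scaleC[OF U] UT flip: Tw[OF that])
  have Uh: "is_parseval_frame I (\<lambda>i. U (h i)) UNIV"
    \<comment> \<open>Moving \<open>U\<close> across the inner product makes these the coefficients
      of \<open>T x\<close> with respect to \<open>h\<close>, and \<open>T\<close> preserves
      norms.\<close>
    unfolding is_parseval_frame_def frame_bounds_def adj[symmetric]
  proof (intro conjI ballI)
    fix x
    show "(\<lambda>i. (cmod (cinner (T x) (h i)))\<^sup>2) summable_on I"
      "1 * (norm x)\<^sup>2 \<le> (\<Sum>\<^sub>\<infinity>i\<in>I. (cmod (cinner (T x) (h i)))\<^sup>2)"
      "(\<Sum>\<^sub>\<infinity>i\<in>I. (cmod (cinner (T x) (h i)))\<^sup>2) \<le> 1 * (norm x)\<^sup>2"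
      using assms(8) unfolding is_parseval_frame_def frame_bounds_def norm_T[of x, symmetric] by simp_all
  qed simp
  have wUh: "((\<lambda>k. cinner (U (h k)) (U (h i)) * cinner (f k) (u j)) has_sum cinner (f i) (u j)) I"
    if "i \<in> I" "j \<in> I" for i j
  proof -
    have "((\<lambda>k. cinner (U (h k)) (U (h i)) * cinner (f k) (u j)) has_sum cinner (w j) (U (h i))) I"
      using has_sum_cinner_left[OF w[OF that(2)], of "U (h i)"]
      by (simp add: cinner_scaleC_left mult.commute)
    \<comment> \<open>The biorthogonality of \<open>p\<close> and \<open>h\<close> is carried over
      by the same adjoint relation, since T w_j = p_j.\<close>
    moreover have "cinner (w j) (U (h i)) = cinner (f i) (u j)"
      by (simp only: adj[symmetric] Tw[OF that(2)] ph[OF that])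
    ultimately show ?thesis
      by simp
  qed
  have "is_weak_R_dual I w f u (\<lambda>i. U (h i))"
    using assms(9) Uh w wUh by (simp add: is_weak_R_dual_def)
  then show ?thesis
    using coisometry w Uh by (intro exI[of _ U] conjI impI ballI) assumption+
qed

end
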